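(* Let $\Gamma=\{\lambda\in\mathbb{C}\setminus\{0,1\}: |\lambda|\le1,\ |1-\lambda|\le1\}$. If $\lambda\in\Gamma$ and $A=\omega_1\overline{\omega_2}-\omega_2\overline{\omega_1}$ with $\omega_1=\omega_1(\lambda)$, $\omega_2=\omega_2(\lambda)$, then $$|A|\ge\max\left\{\frac4\pi\left(\log\max\{|\lambda|^{-1},|1-\lambda|^{-1}\}-\log(11)\right),\ 2\sqrt3\right\}.$$
   Context: $\omega_1=\int_1^\infty\frac{dX}{\sqrt{X(X-1)(X-\lambda)}}$ (along the real line, square root on the plane cut along the negative real axis with $\sqrt1=1$), and $\omega_2=\int_0^{-\infty}\frac{dX}{\sqrt{X(X-1)(X-\lambda)}}$ (along the real line, square root on the plane cut along the positive real axis with $\sqrt{-1}=i$). In the interior of $\Gamma$ these equal $\pi F(\lambda)$ and $i\pi F(1-\lambda)$, where $F(\lambda)=\sum_{n\ge0}\frac{(1/2)_n^2}{n!^2}\lambda^n$; they form a basis of the period lattice of the differential $\frac{dX}{2Y}$ on the Legendre curve $Y^2=X(X-1)(X-\lambda)$. *)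

theory Defs
  imports "HOL-Analysis.Analysis"
begin

definition Legendre_region :: "complex set" ("\<Gamma>") where
  "\<Gamma> = {lam \<in> UNIV - {0, 1}. cmod lam \<le> 1 \<and> cmod (1 - lam) \<le> 1}"

text \<open>
  The branch of the square root on the plane cut along the positive real axis whose
  value at \<open>-1\<close> is \<open>\<i>\<close>. The branch on the plane cut along the negative real axis with value
  \<open>1\<close> at \<open>1\<close> is \<^const>\<open>csqrt\<close>.
\<close>

definition csqrt_pos :: "complex \<Rightarrow> complex" where
  "csqrt_pos z = \<i> * csqrt (- z)"

lemma csqrt_pos_power2: "(csqrt_pos z)\<^sup>2 = z"
  by (simp add: csqrt_pos_def power_mult_distrib)

lemma csqrt_pos_minus_one: "csqrt_pos (- 1) = \<i>"
  by (simp add: csqrt_pos_def)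

lemma continuous_on_csqrt_pos: "continuous_on (- \<real>\<^sub>\<ge>\<^sub>0) csqrt_pos"
proof -
  have "continuous_on (- \<real>\<^sub>\<ge>\<^sub>0) (\<lambda>z::complex. csqrt (- z))"
    by (rule continuous_on_compose2[where t = "- \<real>\<^sub>\<le>\<^sub>0"])
       (auto intro!: continuous_intros continuous_on_csqrt
             simp: complex_nonneg_Reals_iff complex_nonpos_Reals_iff)
  then show ?thesis
    unfolding csqrt_pos_def by (intro continuous_intros)
qed

definition \<omega>\<^sub>1 :: "complex \<Rightarrow> complex" where
  "\<omega>\<^sub>1 lam = (LBINT X=1..\<infinity>. 1 / csqrt (of_real X * (of_real X - 1) * (of_real X - lam)))"

text \<open>
  The endpoints of the next integral are in decreasing order, so the interval integral is minus
  the integral over the negative half-line, which is the orientation from \<open>0\<close> to \<open>-\<infinity>\<close>.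
\<close>

definition \<omega>\<^sub>2 :: "complex \<Rightarrow> complex" where
  "\<omega>\<^sub>2 lam = (LBINT X=0..-\<infinity>. 1 / csqrt_pos (of_real X * (of_real X - 1) * (of_real X - lam)))"

end

theory Submission
  imports Defs
begin

text \<open>
  With \<open>G \<mu> = \<integral>\<^sub>0\<^sup>\<infinity> dt / (sqrt (t (t + 1)) csqrt (t + \<mu>))\<close> the periods are
  \<open>\<omega>\<^sub>1 = G (1 - \<lambda>)\<close> and \<open>\<omega>\<^sub>2 = \<i> G \<lambda>\<close>, so \<open>|A| = 2 |Re (G \<lambda> cnj (G (1 - \<lambda>)))|\<close>. For
  \<open>s, t > 0\<close> the numbers \<open>\<lambda> + s\<close> and \<open>1 - \<lambda> + t\<close> enclose an angle of at most \<open>2 \<pi> / 3\<close>, their square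
  roots one of at most \<open>\<pi> / 3\<close>, and hence \<open>|A| \<ge> N \<lambda> N (1 - \<lambda>)\<close>, where \<open>N \<mu>\<close> is the
  integral of the absolute value of the integrand of \<open>G \<mu>\<close>. From \<open>|t + \<mu>| \<le> t + 1\<close> one gets
  \<open>N \<mu> \<ge> \<pi>\<close>, and from \<open>|t + \<mu>| \<le> 2 t\<close> on \<open>[|\<mu>|, 1]\<close> one gets \<open>N \<mu> \<ge> ln (1 / |\<mu>|) / 2\<close>.
  These bounds suffice since \<open>\<pi>\<^sup>2 \<ge> 8\<close> and \<open>\<pi>\<^sup>2 \<ge> 2 sqrt 3\<close>.
\<close>

section \<open>Passing an angle bound from integrands to integrals\<close>

text \<open>The pointwise bound is integrated first in \<open>x\<close> with \<open>y\<close> fixed,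
  then in \<open>y\<close>; linearity turns each into a single integral, so no double integral
  appears.\<close>

lemma Re_mult_cnj_integral_ge:
  fixes f h :: "real \<Rightarrow> complex"
  assumes f: "integrable M f" and h: "integrable M h"
    and le: "\<And>x y. Re (f x * cnj (h y)) \<ge> c * (cmod (f x) * cmod (h y))"
  shows "Re ((\<integral>x. f x \<partial>M) * cnj (\<integral>y. h y \<partial>M)) \<ge>
    c * ((\<integral>x. cmod (f x) \<partial>M) * (\<integral>y. cmod (h y) \<partial>M))"
proof -
  have inner: "c * cmod (h y) * (\<integral>x. cmod (f x) \<partial>M) \<le> Re ((\<integral>x. f x \<partial>M) * cnj (h y))" for y
  proof -
    have "(\<integral>x. c * cmod (h y) * cmod (f x) \<partial>M) \<le> (\<integral>x. Re (f x * cnj (h y)) \<partial>M)"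
      using f le[of _ y] by (intro integral_mono) (auto simp: mult_ac)
    also have "\<dots> = Re (\<integral>x. f x * cnj (h y) \<partial>M)"
      using f by (intro integral_Re) auto
    finally show ?thesis by simp
  qed
  have "(\<integral>y. c * (\<integral>x. cmod (f x) \<partial>M) * cmod (h y) \<partial>M) \<le>
      (\<integral>y. Re ((\<integral>x. f x \<partial>M) * cnj (h y)) \<partial>M)"
    using h inner by (intro integral_mono) (auto simp: mult_ac)
  also have "\<dots> = Re (\<integral>y. (\<integral>x. f x \<partial>M) * cnj (h y) \<partial>M)"
    using h by (intro integral_Re) auto
  finally show ?thesis
    by (simp add: mult_ac)
qed

section \<open>The periods as half-line integrals\<close>

lemma csqrt_of_real_mult:
  assumes "a \<ge> 0"
  shows "csqrt (of_real a * z) = of_real (sqrt a) * csqrt z"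
proof (cases "a = 0")
  case False
  show ?thesis
  proof (rule csqrt_unique)
    show "(complex_of_real (sqrt a) * csqrt z)\<^sup>2 = of_real a * z"
      using assms by (simp add: power_mult_distrib flip: of_real_power)
    show "0 < Re (complex_of_real (sqrt a) * csqrt z) \<or>
        Re (complex_of_real (sqrt a) * csqrt z) = 0 \<and> 0 \<le> Im (complex_of_real (sqrt a) * csqrt z)"
      using assms False csqrt_principal[of z] by auto
  qed
qed simp

text \<open>The positive factor \<open>t * (t + 1)\<close> is taken out of the complex root, so the
  argument of the integrand comes from \<open>csqrt (of_real t + \<mu>)\<close> alone. The indicator
  makes it a function on the whole line.\<close>

definition half_line_integrand :: "complex \<Rightarrow> real \<Rightarrow> complex" where
  "half_line_integrand \<mu> t =
     indicat_real {0<..} t *\<^sub>R (1 / (of_real (sqrt (t * (t + 1))) * csqrt (of_real t + \<mu>)))"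

lemma norm_half_line_integrand:
  "cmod (half_line_integrand \<mu> t) =
     indicat_real {0<..} t / (sqrt (t * (t + 1)) * sqrt (cmod (of_real t + \<mu>)))"
  by (auto simp: half_line_integrand_def norm_divide norm_mult indicator_def)

text \<open>Substitution \<open>X = 1 + t\<close>.\<close>

lemma \<omega>\<^sub>1_eq_half_line: "\<omega>\<^sub>1 lam = (LBINT t. half_line_integrand (1 - lam) t)"
proof -
  let ?f = "\<lambda>X. 1 / csqrt (of_real X * (of_real X - 1) * (of_real X - lam))"
  have "\<omega>\<^sub>1 lam = (LBINT X. indicat_real {1<..} X *\<^sub>R ?f X)"
    by (simp add: \<omega>\<^sub>1_def interval_lebesgue_integral_def set_lebesgue_integral_def one_ereal_def)
  also have "\<dots> = (LBINT t. indicat_real {1<..} (1 + t) *\<^sub>R ?f (1 + t))"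
    using lborel_integral_real_affine[of 1 "\<lambda>X. indicat_real {1<..} X *\<^sub>R ?f X" 1] by simp
  also have "\<dots> = (LBINT t. half_line_integrand (1 - lam) t)"
  proof (intro Bochner_Integration.integral_cong refl)
    fix t :: real
    have *: "of_real (1 + t) * (of_real (1 + t) - 1) * (of_real (1 + t) - lam) =
        of_real (t * (t + 1)) * (of_real t + (1 - lam))"
      by (simp add: algebra_simps)
    show "indicat_real {1<..} (1 + t) *\<^sub>R ?f (1 + t) = half_line_integrand (1 - lam) t"
      unfolding half_line_integrand_def *
      by (cases "t > 0") (simp_all add: csqrt_of_real_mult del: of_real_mult of_real_add)
  qed
  finally show ?thesis .
qed

text \<open>Substitution \<open>X = - t\<close>. The factor \<open>\<i>\<close> in
  \<open>csqrt_pos\<close> contributes \<open>1 / \<i> = - \<i>\<close>, and the reversed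
  orientation turns this into \<open>\<i>\<close>.\<close>

lemma \<omega>\<^sub>2_eq_half_line: "\<omega>\<^sub>2 lam = \<i> * (LBINT t. half_line_integrand lam t)"
proof -
  let ?f = "\<lambda>X. 1 / csqrt_pos (of_real X * (of_real X - 1) * (of_real X - lam))"
  have "\<omega>\<^sub>2 lam = - (LBINT X. indicat_real {..<0} X *\<^sub>R ?f X)"
    by (simp add: \<omega>\<^sub>2_def interval_lebesgue_integral_def set_lebesgue_integral_def zero_ereal_def)
  also have "(LBINT X. indicat_real {..<0} X *\<^sub>R ?f X) =
      (LBINT t. indicat_real {..<0} (- t) *\<^sub>R ?f (- t))"
    using lborel_integral_real_affine[of "-1" "\<lambda>X. indicat_real {..<0} X *\<^sub>R ?f X" 0] by simp
  also have "\<dots> = (LBINT t. - \<i> * half_line_integrand lam t)"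
  proof (intro Bochner_Integration.integral_cong refl)
    fix t :: real
    have *: "- (of_real (- t) * (of_real (- t) - 1) * (of_real (- t) - lam)) =
        of_real (t * (t + 1)) * (of_real t + lam)"
      by (simp add: algebra_simps)
    show "indicat_real {..<0} (- t) *\<^sub>R ?f (- t) = - \<i> * half_line_integrand lam t"
      unfolding half_line_integrand_def csqrt_pos_def *
      by (cases "t > 0")
        (simp_all add: csqrt_of_real_mult divide_simps del: of_real_mult of_real_add)
  qed
  finally show ?thesis by simp
qed

section \<open>Integrability and lower bounds for the integral of the absolute value\<close>

text \<open>This comparison function is used twice: a multiple of it dominates
  \<open>half_line_integrand\<close>, and it is itself a lower bound for the absolute value.\<close>

lemma integral_inverse_sqrt_mult_add_one:
  shows "integrable lborel (\<lambda>t. indicat_real {0<..} t / (sqrt t * (t + 1)))"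
    and "(LBINT t. indicat_real {0<..} t / (sqrt t * (t + 1))) = pi"
proof -
  let ?f = "\<lambda>t::real. 1 / (sqrt t * (t + 1))" and ?F = "\<lambda>t::real. 2 * arctan (sqrt t)"
  have deriv: "DERIV ?F t :> ?f t" if "t > 0" for t
  proof -
    have "DERIV ?F t :> 2 * (inverse (1 + (sqrt t)\<^sup>2) * (inverse (sqrt t) / 2))"
      using that by (intro DERIV_cmult DERIV_chain2[OF DERIV_arctan] DERIV_real_sqrt)
    also have "2 * (inverse (1 + (sqrt t)\<^sup>2) * (inverse (sqrt t) / 2)) = ?f t"
      using that by (simp add: divide_simps)
    finally show ?thesis .
  qed
  have cont: "isCont ?f t" if "t > 0" for t
    using that by (auto intro!: continuous_intros)
  \<comment> \<open>The integrand is unbounded at 0 and the range is infinite, so the antiderivative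
    enters through its limits at both ends.\<close>
  have at0: "(?F \<longlongrightarrow> 0) (at_right 0)"
    by (auto intro!: tendsto_eq_intros)
  have at_inf: "(?F \<longlongrightarrow> 2 * (pi / 2)) at_top"
    by (rule tendsto_mult[OF tendsto_const filterlim_compose[OF tendsto_arctan_at_top sqrt_at_top]])
  have lim: "((?F \<circ> real_of_ereal) \<longlongrightarrow> 0) (at_right 0)"
    "((?F \<circ> real_of_ereal) \<longlongrightarrow> 2 * (pi / 2)) (at_left \<infinity>)"
    using at0 at_inf unfolding zero_ereal_def ereal_tendsto_simps .
  have "set_integrable lborel (einterval 0 \<infinity>) ?f" "(LBINT t=0..\<infinity>. ?f t) = 2 * (pi / 2) - 0"
    by (rule interval_integral_FTC_nonneg[OF _ _ _ _ lim];
        use deriv cont in \<open>simp add: zero_ereal_def\<close>)+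
  then show "integrable lborel (\<lambda>t. indicat_real {0<..} t / (sqrt t * (t + 1)))"
    and "(LBINT t. indicat_real {0<..} t / (sqrt t * (t + 1))) = pi"
    by (simp_all add: set_integrable_def interval_lebesgue_integral_def set_lebesgue_integral_def
        zero_ereal_def)
qed

text \<open>Since \<open>Re \<mu> > 0\<close>, both \<open>t\<close> and \<open>cmod \<mu>\<close>
  are at most \<open>cmod (of_real t + \<mu>)\<close>. Hence \<open>t + 1\<close> is at most
  \<open>2 / cmod \<mu>\<close> times that modulus, which gives the constant
  \<open>?K\<close>.\<close>

lemma integrable_half_line_integrand:
  assumes "Re \<mu> > 0" "cmod \<mu> \<le> 1"
  shows "integrable lborel (half_line_integrand \<mu>)"
proof (rule Bochner_Integration.integrable_bound)
  let ?K = "sqrt (2 / cmod \<mu>)"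
  have "\<mu> \<noteq> 0" using assms by auto
  show "integrable lborel (\<lambda>t. ?K * (indicat_real {0<..} t / (sqrt t * (t + 1))))"
    by (intro integrable_mult_right integral_inverse_sqrt_mult_add_one)
  have nz: "of_real t + \<mu> \<noteq> 0" if "t > 0" for t
    using assms that by (auto simp: complex_eq_iff)
  \<comment> \<open>For \<open>t > 0\<close> the point \<open>of_real t + \<mu>\<close> has positive
    real part and so avoids the branch cut.\<close>
  have "half_line_integrand \<mu> \<in> borel_measurable borel"
    unfolding half_line_integrand_def[abs_def]
    using assms
    by (intro borel_measurable_continuous_on_indicator continuous_intros
        continuous_on_compose2[OF continuous_on_csqrt])
      (auto simp: complex_nonpos_Reals_iff nz)
  then show "half_line_integrand \<mu> \<in> borel_measurable lborel"
    by simp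
  have "cmod (half_line_integrand \<mu> t) \<le> norm (?K * (indicat_real {0<..} t / (sqrt t * (t + 1))))"
    for t
  proof (cases "t > 0")
    case True
    have "t \<le> cmod (of_real t + \<mu>)"
      using complex_Re_le_cmod[of "of_real t + \<mu>"] assms by simp
    moreover have "cmod \<mu> \<le> cmod (of_real t + \<mu>)"
      unfolding cmod_def using assms True
      by (intro real_sqrt_le_mono) (auto simp: power2_eq_square intro!: mult_mono)
    moreover have "cmod \<mu> * t \<le> t"
      using assms True by (simp add: mult_le_cancel_right1)
    ultimately have "cmod \<mu> * (t + 1) \<le> 2 * cmod (of_real t + \<mu>)"
      by (simp add: algebra_simps)
    then have "t + 1 \<le> 2 / cmod \<mu> * cmod (of_real t + \<mu>)"
      using \<open>\<mu> \<noteq> 0\<close> by (simp add: field_simps)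
    then have "sqrt (t + 1) \<le> ?K * sqrt (cmod (of_real t + \<mu>))"
      by (simp flip: real_sqrt_mult)
    moreover have "cmod (of_real t + \<mu>) > 0"
      using \<open>t \<le> _\<close> True by linarith
    ultimately have "1 / sqrt (cmod (of_real t + \<mu>)) \<le> ?K / sqrt (t + 1)"
      using True by (simp add: field_simps)
    then have "1 / sqrt (t * (t + 1)) * (1 / sqrt (cmod (of_real t + \<mu>))) \<le>
        1 / sqrt (t * (t + 1)) * (?K / sqrt (t + 1))"
      using True by (intro mult_left_mono) auto
    also have "\<dots> = ?K * (1 / (sqrt t * (t + 1)))"
      using True by (simp add: real_sqrt_mult)
    finally show ?thesis
      using True by (simp add: norm_half_line_integrand)
  qed (simp add: norm_half_line_integrand)
  then show "AE t in lborel. cmod (half_line_integrand \<mu> t) \<le>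
      norm (?K * (indicat_real {0<..} t / (sqrt t * (t + 1))))"
    by simp
qed

lemma integral_norm_half_line_ge_pi:
  assumes "Re \<mu> > 0" "cmod \<mu> \<le> 1"
  shows "(LBINT t. cmod (half_line_integrand \<mu> t)) \<ge> pi"
proof -
  have "(LBINT t. indicat_real {0<..} t / (sqrt t * (t + 1))) \<le>
      (LBINT t. cmod (half_line_integrand \<mu> t))"
  proof (intro integral_mono integral_inverse_sqrt_mult_add_one integrable_norm
      integrable_half_line_integrand assms)
    fix t :: real
    show "indicat_real {0<..} t / (sqrt t * (t + 1)) \<le> cmod (half_line_integrand \<mu> t)"
    proof (cases "t > 0")
      case True
      have "cmod (of_real t + \<mu>) \<le> t + 1"
        using norm_triangle_ineq[of "of_real t" \<mu>] assms True by simp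
      moreover have "cmod (of_real t + \<mu>) > 0"
        using assms True by (auto simp: complex_eq_iff)
      \<comment> \<open>In this form the two denominators differ in one factor only.\<close>
      moreover have "sqrt (t * (t + 1)) * sqrt (t + 1) = sqrt t * (t + 1)"
        using True by (simp add: real_sqrt_mult)
      ultimately show ?thesis
        using True by (auto simp: norm_half_line_integrand intro!: divide_left_mono mult_mono
            simp flip: \<open>sqrt (t * (t + 1)) * sqrt (t + 1) = _\<close>)
    qed (simp add: norm_half_line_integrand)
  qed
  then show ?thesis
    by (simp add: integral_inverse_sqrt_mult_add_one)
qed

text \<open>On \<open>{cmod \<mu>..1}\<close> also \<open>t + 1 \<le> 2\<close>, so the denominator
  is at most \<open>sqrt (t * 2) * sqrt (2 * t) = 2 * t\<close>; elsewhere the integrand is bounded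
  below by 0.\<close>

lemma integral_norm_half_line_ge_ln:
  assumes "Re \<mu> > 0" "cmod \<mu> \<le> 1"
  shows "(LBINT t. cmod (half_line_integrand \<mu> t)) \<ge> ln (inverse (cmod \<mu>)) / 2"
proof -
  have r: "cmod \<mu> > 0" using assms by auto
  have pos: "t > 0" if "cmod \<mu> \<le> t" for t using r that by linarith
  let ?f = "\<lambda>t::real. 1 / (2 * t)"
  have deriv: "DERIV (\<lambda>t. ln t / 2) t :> ?f t" if "t > 0" for t :: real
    using that by (auto intro!: derivative_eq_intros simp: field_simps)
  have cont: "isCont ?f t" if "t > 0" for t
    using that by (auto intro!: continuous_intros)
  have "has_bochner_integral lborel (\<lambda>t. ?f t * indicator {cmod \<mu>..1} t) (ln 1 / 2 - ln (cmod \<mu>) / 2)"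
    by (rule has_bochner_integral_FTC_Icc_real[OF assms(2) deriv[OF pos] cont[OF pos]])
  then have int: "integrable lborel (\<lambda>t. ?f t * indicator {cmod \<mu>..1} t)"
    and eq: "(LBINT t. ?f t * indicator {cmod \<mu>..1} t) = ln (inverse (cmod \<mu>)) / 2"
    using r by (auto simp: has_bochner_integral_iff ln_inverse)
  have "(LBINT t. ?f t * indicator {cmod \<mu>..1} t) \<le> (LBINT t. cmod (half_line_integrand \<mu> t))"
  proof (intro integral_mono int integrable_norm integrable_half_line_integrand assms)
    fix t :: real
    show "?f t * indicator {cmod \<mu>..1} t \<le> cmod (half_line_integrand \<mu> t)"
    proof (cases "t \<in> {cmod \<mu>..1}")
      case True
      then have t: "t > 0" "t \<le> 1" using pos by auto
      have "cmod (of_real t + \<mu>) \<le> 2 * t"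
        using norm_triangle_ineq[of "of_real t" \<mu>] True t by simp
      moreover have "cmod (of_real t + \<mu>) > 0"
        using assms t by (auto simp: complex_eq_iff)
      moreover have "sqrt (t * (t + 1)) * sqrt (cmod (of_real t + \<mu>)) \<le> 2 * t"
      proof -
        have "sqrt (t * (t + 1)) * sqrt (cmod (of_real t + \<mu>)) \<le> sqrt (t * 2) * sqrt (2 * t)"
          using t \<open>cmod (of_real t + \<mu>) \<le> 2 * t\<close> by (intro mult_mono real_sqrt_le_mono) auto
        also have "\<dots> = 2 * t"
          using t by (simp add: mult.commute)
        finally show ?thesis .
      qed
      ultimately show ?thesis
        using True t by (auto simp: norm_half_line_integrand intro!: divide_left_mono)
    qed simp
  qed
  then show ?thesis
    by (simp only: eq)
qed

section \<open>The angle between the two integrands\<close>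

text \<open>After squaring, the angle bound holds because \<open>p + q\<close> is the longest side of the triangle with
  sides \<open>p\<close>, \<open>q\<close>, \<open>p + q\<close>.\<close>
lemma Re_csqrt_mult_cnj_csqrt_ge:
  assumes "Re p > 0" "Re q > 0" "cmod p \<le> cmod (p + q)" "cmod q \<le> cmod (p + q)"
  shows "Re (csqrt p * cnj (csqrt q)) \<ge> 1 / 2 * (cmod (csqrt p) * cmod (csqrt q))"
proof -
  define z where "z = csqrt p * cnj (csqrt q)"
  have norm_z: "(cmod z)\<^sup>2 = cmod p * cmod q"
    by (simp add: z_def norm_mult power_mult_distrib)
  have "z\<^sup>2 = p * cnj q"
    by (simp add: z_def power_mult_distrib flip: complex_cnj_power)
  have "(cmod (p + q))\<^sup>2 = (cmod p)\<^sup>2 + (cmod q)\<^sup>2 + 2 * Re (p * cnj q)"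
    unfolding cmod_power2 by (simp add: power2_eq_square algebra_simps)
  \<comment> \<open>The square of the smaller modulus is at most the product of the two, and the
    larger modulus is at most \<open>cmod (p + q)\<close>.\<close>
  moreover have "(cmod p)\<^sup>2 + (cmod q)\<^sup>2 - cmod p * cmod q \<le> (cmod (p + q))\<^sup>2"
  proof (cases "cmod p \<le> cmod q")
    case True
    then have "cmod p * cmod p \<le> cmod p * cmod q" by (intro mult_left_mono) auto
    moreover have "(cmod q)\<^sup>2 \<le> (cmod (p + q))\<^sup>2" using assms by (intro power_mono) auto
    ultimately show ?thesis by (simp add: power2_eq_square)
  next
    case False
    then have "cmod q * cmod q \<le> cmod p * cmod q" by (intro mult_right_mono) auto
    moreover have "(cmod p)\<^sup>2 \<le> (cmod (p + q))\<^sup>2" using assms by (intro power_mono) auto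
    ultimately show ?thesis by (simp add: power2_eq_square)
  qed
  ultimately have "Re (z\<^sup>2) \<ge> - (1 / 2) * (cmod z)\<^sup>2"
    using norm_z \<open>z\<^sup>2 = _\<close> by simp
  \<comment> \<open>Half-angle step:
    \<open>Re (z\<^sup>2) = 2 * (Re z)\<^sup>2 - (cmod z)\<^sup>2\<close>.\<close>
  then have "(cmod z / 2)\<^sup>2 \<le> (Re z)\<^sup>2"
    by (simp add: cmod_power2 Re_power2 power_divide field_simps)
  \<comment> \<open>This fixes the sign lost by squaring: both roots have argument at most pi/4 in
    absolute value, so theirs differ by at most pi/2.\<close>
  moreover have "Re z \<ge> 0"
  proof -
    have "\<bar>Im (csqrt w)\<bar> \<le> Re (csqrt w)" if "Re w > 0" for w
      using that complex_Re_le_cmod[of w] by (auto simp: abs_mult sgn_if intro!: real_sqrt_le_mono)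
    from this[OF assms(1)] this[OF assms(2)]
    have "\<bar>Im (csqrt p) * Im (csqrt q)\<bar> \<le> Re (csqrt p) * Re (csqrt q)"
      unfolding abs_mult by (intro mult_mono) (auto simp only: abs_ge_zero Re_csqrt)
    then show ?thesis by (simp add: z_def abs_le_iff)
  qed
  ultimately have "cmod z / 2 \<le> Re z"
    using power2_le_imp_le by blast
  then show ?thesis by (simp add: z_def norm_mult)
qed

lemma Re_half_line_integrand_ge:
  assumes "Re lam > 0" "Re lam < 1" "cmod lam \<le> 1" "cmod (1 - lam) \<le> 1"
  shows "Re (half_line_integrand lam s * cnj (half_line_integrand (1 - lam) t)) \<ge>
    1 / 2 * (cmod (half_line_integrand lam s) * cmod (half_line_integrand (1 - lam) t))"
proof (cases "s > 0 \<and> t > 0")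
  case True
  define p q where "p = of_real s + lam" and "q = of_real t + (1 - lam)"
  define c where "c = 1 / (sqrt (s * (s + 1)) * sqrt (t * (t + 1)) * cmod p * cmod q)"
  have "c \<ge> 0" using True by (simp add: c_def)
  \<comment> \<open>The imaginary parts cancel, and \<open>s + t + 1\<close> exceeds the bounds
    \<open>s + 1\<close> and \<open>t + 1\<close> for the other two sides of the triangle.\<close>
  have "p + q = of_real (s + t + 1)" by (simp add: p_def q_def)
  then have "cmod (p + q) = s + t + 1" using True by (simp only: norm_of_real) simp
  moreover have "cmod p \<le> s + 1" "cmod q \<le> t + 1"
    using norm_triangle_ineq[of "of_real s" lam] norm_triangle_ineq[of "of_real t" "1 - lam"]
      assms True by (auto simp: p_def q_def)
  ultimately have ge: "Re (csqrt q * cnj (csqrt p)) \<ge> 1 / 2 * (cmod (csqrt q) * cmod (csqrt p))"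
    using assms True
    by (intro Re_csqrt_mult_cnj_csqrt_ge) (auto simp: add.commute p_def q_def)
  \<comment> \<open>A reciprocal is a positive multiple of the conjugate, so the angle survives with
    \<open>p\<close> and \<open>q\<close> exchanged; \<open>c\<close> collects the positive
    factors.\<close>
  have inv: "1 / csqrt w = cnj (csqrt w) / of_real (cmod w)" for w
    using complex_div_cnj[of 1 "csqrt w"] by (simp flip: of_real_power)
  have eq: "half_line_integrand lam s * cnj (half_line_integrand (1 - lam) t) =
      of_real c * (csqrt q * cnj (csqrt p))"
  proof -
    have "half_line_integrand lam s * cnj (half_line_integrand (1 - lam) t) =
        of_real (1 / (sqrt (s * (s + 1)) * sqrt (t * (t + 1)))) * (1 / csqrt p * cnj (1 / csqrt q))"
      using True by (simp add: half_line_integrand_def p_def q_def)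
    then show ?thesis
      unfolding inv by (simp add: c_def mult_ac)
  qed
  have "cmod (half_line_integrand lam s) * cmod (half_line_integrand (1 - lam) t) =
      cmod (half_line_integrand lam s * cnj (half_line_integrand (1 - lam) t))"
    by (simp add: norm_mult)
  also have "\<dots> = c * (cmod (csqrt q) * cmod (csqrt p))"
    unfolding eq using \<open>c \<ge> 0\<close> by (simp add: norm_mult)
  finally show ?thesis
    unfolding eq using mult_left_mono[OF ge \<open>c \<ge> 0\<close>] by simp
qed (auto simp: half_line_integrand_def)

section \<open>Combination of the estimates\<close>

theorem lemma6:
  fixes lam A :: complex
  assumes "lam \<in> \<Gamma>"
    and "A = \<omega>\<^sub>1 lam * cnj (\<omega>\<^sub>2 lam) - \<omega>\<^sub>2 lam * cnj (\<omega>\<^sub>1 lam)"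
  shows "cmod A \<ge>
    max (4 / pi * (ln (max (inverse (cmod lam)) (inverse (cmod (1 - lam)))) - ln 11)) (2 * sqrt 3)"
proof -
  \<comment> \<open>The closed unit disc around 1 meets the imaginary axis only at 0. Applied to
    \<open>lam\<close> and to \<open>1 - lam\<close>.\<close>
  have Re_pos: "Re \<mu> > 0" if "\<mu> \<noteq> 0" "cmod (1 - \<mu>) \<le> 1" for \<mu>
  proof -
    have "(cmod (1 - \<mu>))\<^sup>2 \<le> 1" using that by (simp add: power_le_one)
    then have "(cmod \<mu>)\<^sup>2 \<le> 2 * Re \<mu>"
      unfolding cmod_power2 by (simp add: power2_eq_square algebra_simps)
    moreover have "(cmod \<mu>)\<^sup>2 > 0" using that by simp
    ultimately show ?thesis by linarith
  qed
  have lam: "Re lam > 0" "Re (1 - lam) > 0" "cmod lam \<le> 1" "cmod (1 - lam) \<le> 1"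
    using assms(1) Re_pos[of lam] Re_pos[of "1 - lam"] by (auto simp: Legendre_region_def)
  define G where "G \<mu> = (LBINT t. half_line_integrand \<mu> t)" for \<mu>
  define N where "N \<mu> = (LBINT t. cmod (half_line_integrand \<mu> t))" for \<mu>
  \<comment> \<open>\<open>A\<close> is a number minus its conjugate, hence purely imaginary; the
    conjugate of the factor \<open>\<i>\<close> in \<open>\<omega>\<^sub>2\<close> turns the
    imaginary part into a real part.\<close>
  have "A = - 2 * \<i> * of_real (Re (G lam * cnj (G (1 - lam))))"
    unfolding assms(2) \<omega>\<^sub>1_eq_half_line \<omega>\<^sub>2_eq_half_line G_def[symmetric]
    by (simp add: complex_eq_iff algebra_simps)
  then have "cmod A = 2 * \<bar>Re (G lam * cnj (G (1 - lam)))\<bar>"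
    by (simp only: norm_mult norm_of_real) simp
  moreover have "Re (G lam * cnj (G (1 - lam))) \<ge> 1 / 2 * (N lam * N (1 - lam))"
    unfolding G_def N_def using lam
    by (intro Re_mult_cnj_integral_ge integrable_half_line_integrand Re_half_line_integrand_ge) auto
  ultimately have A_ge: "cmod A \<ge> N lam * N (1 - lam)" by linarith
  have N_pi: "N lam \<ge> pi" "N (1 - lam) \<ge> pi"
    unfolding N_def using integral_norm_half_line_ge_pi lam by blast+
  have N_ln: "N lam \<ge> ln (inverse (cmod lam)) / 2"
    "N (1 - lam) \<ge> ln (inverse (cmod (1 - lam))) / 2"
    unfolding N_def using integral_norm_half_line_ge_ln lam by blast+
  have pi: "pi \<ge> 3" using pi_approx by simp
  define L where "L = ln (max (inverse (cmod lam)) (inverse (cmod (1 - lam))))"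
  have "L \<ge> 0"
    using lam by (auto simp: L_def le_max_iff_disj one_le_inverse_iff intro!: ln_ge_zero)
  \<comment> \<open>The factor belonging to the larger reciprocal takes the logarithmic bound, the
    other one takes \<open>pi\<close>.\<close>
  have "pi * (L / 2) \<le> N lam * N (1 - lam)"
  proof (cases "inverse (cmod lam) \<le> inverse (cmod (1 - lam))")
    case True
    then have "L / 2 \<le> N (1 - lam)" using N_ln by (simp add: L_def max_def)
    then show ?thesis using N_pi \<open>L \<ge> 0\<close> pi by (intro mult_mono) auto
  next
    case False
    then have "L / 2 \<le> N lam" using N_ln by (simp add: L_def max_def)
    then have "L / 2 * pi \<le> N lam * N (1 - lam)" using N_pi \<open>L \<ge> 0\<close> pi by (intro mult_mono) auto
    then show ?thesis by (simp add: mult.commute)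
  qed
  \<comment> \<open>Subtracting \<open>ln 11\<close> lowers the left side, and
    \<open>4 / pi \<le> pi / 2\<close> amounts to \<open>8 \<le> pi * pi\<close>.\<close>
  moreover have "4 / pi * (L - ln 11) \<le> pi * (L / 2)"
  proof -
    have "9 \<le> pi * pi" using mult_mono[OF pi pi] by simp
    then have "4 / pi \<le> pi / 2" using pi by (simp add: field_simps)
    have "4 / pi * (L - ln 11) \<le> 4 / pi * L" by (intro mult_left_mono) auto
    also have "\<dots> \<le> pi / 2 * L"
      using \<open>4 / pi \<le> pi / 2\<close> \<open>L \<ge> 0\<close> by (intro mult_right_mono)
    finally show ?thesis by simp
  qed
  moreover have "2 * sqrt 3 \<le> N lam * N (1 - lam)"
  proof -
    have "2 * sqrt 3 \<le> 2 * 2" by (intro mult_left_mono real_le_lsqrt) auto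
    also have "\<dots> \<le> 3 * (3::real)" by simp
    also have "\<dots> \<le> N lam * N (1 - lam)" using N_pi pi by (intro mult_mono) auto
    finally show ?thesis .
  qed
  ultimately show ?thesis
    using A_ge unfolding L_def[symmetric] by (intro max.boundedI) linarith+
qed

end
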